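(* Let $\xi=(\xi_t)_{t\ge 0}$ be a real-valued L\'evy process which drifts to $\infty$ and is not a pure drift. Let $\mathcal{I}$ be the support of the law $\mu$ of the dual exponential functional $\hat I$, $\mathcal{I}^o$ its interior, and $U$ the Ornstein-Uhlenbeck type process associated to $\xi$, all as defined in the context. Then $U$ is topologically recurrent, in the sense that for every $x>0$ with $1/x\in\mathcal{I}^o$, $U$ visits every neighborhood of $x$ a.s., no matter its initial value $U(0)$.
   Context: $\xi=(\xi_t)_{t\ge0}$ is a real-valued L\'evy process (started from $0$, with c\`adl\`ag paths), with $\lim_{t\to\infty}\xi_t=\infty$ a.s. ("$\xi$ drifts to $\infty$"). Let $I(t)=\int_0^t \exp(\xi_s)\,\mathrm{d}s$, a.s. a bijection of $[0,\infty)$, with inverse $\tau$. Set $X(t)=\exp(\xi_{\tau(t)})$, a Markov process on $(0,\infty)$ started from $1$; the version of $X$ started from $x>0$ is $(xX(t/x))_{t\ge0}$. The Ornstein-Uhlenbeck type process is $U(t)=\mathrm{e}^{-t}X(\mathrm{e}^t-1)$, $t\ge 0$; it is a Markov process on $(0,\infty)$, whose initial value $U(0)=X(0)\in(0,\infty)$ can be arbitrary. Let $\hat\xi$ be a L\'evy process with the same law as $-\xi$ (the dual L\'evy process), $\hat I=\int_0^\infty \exp(\hat\xi_s)\,\mathrm{d}s$, which is a.s. finite, and $\mu$ the law of $\hat I$. The support $\mathcal{I}$ of $\mu$ is an interval: when $\xi$ is not a pure drift, $\mathcal{I}=[0,1/b]$ if $\xi$ is a non-deterministic subordinator with drift $b>0$,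 $\mathcal{I}=[1/b,\infty)$ if $\xi$ is a non-deterministic L\'evy process of finite variation with no positive jumps and drift $b>0$, and $\mathcal{I}=[0,\infty)$ in the remaining cases. *)

theory Defs
  imports "HOL-Probability.Probability"
begin

text \<open>Processes are indexed by \<^typ>\<open>real\<close>, but only the times \<open>t \<ge> 0\<close> are ever constrained or used.\<close>

definition cadlag :: "(real \<Rightarrow> real) \<Rightarrow> bool" where
  "cadlag f \<longleftrightarrow>
     (\<forall>t\<ge>0. (f \<longlongrightarrow> f t) (at_right t)) \<and>
     (\<forall>t>0. \<exists>l. (f \<longlongrightarrow> l) (at_left t))"

definition levy_process :: "'a measure \<Rightarrow> (real \<Rightarrow> 'a \<Rightarrow> real) \<Rightarrow> bool" where
  "levy_process M \<xi> \<longleftrightarrow>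
     prob_space M \<and>
     (\<forall>t\<ge>0. \<xi> t \<in> borel_measurable M) \<and>
     (AE \<omega> in M. \<xi> 0 \<omega> = 0) \<and>
     (\<forall>\<omega>\<in>space M. cadlag (\<lambda>t. \<xi> t \<omega>)) \<and>
     (\<forall>n (t :: nat \<Rightarrow> real). 0 \<le> t 0 \<and> (\<forall>i<n. t i \<le> t (Suc i)) \<longrightarrow>
        prob_space.indep_vars M (\<lambda>_. borel) (\<lambda>i \<omega>. \<xi> (t (Suc i)) \<omega> - \<xi> (t i) \<omega>) {..<n}) \<and>
     (\<forall>s\<ge>0. \<forall>t\<ge>0. distr M borel (\<lambda>\<omega>. \<xi> (s + t) \<omega> - \<xi> s \<omega>) = distr M borel (\<xi> t))"

definition drifts_to_infinity :: "'a measure \<Rightarrow> (real \<Rightarrow> 'a \<Rightarrow> real) \<Rightarrow> bool" where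
  "drifts_to_infinity M \<xi> \<longleftrightarrow> (AE \<omega> in M. filterlim (\<lambda>t. \<xi> t \<omega>) at_top at_top)"

definition pure_drift :: "'a measure \<Rightarrow> (real \<Rightarrow> 'a \<Rightarrow> real) \<Rightarrow> bool" where
  "pure_drift M \<xi> \<longleftrightarrow> (\<exists>b. AE \<omega> in M. \<forall>t\<ge>0. \<xi> t \<omega> = b * t)"

text \<open>Law of the whole path, as a measure on \<open>\<real>\<close>-valued functions on \<open>[0, \<infinity>)\<close> with the product
  \<open>\<sigma>\<close>-algebra; equality of laws is thus equality of all finite-dimensional distributions.\<close>

definition process_law :: "'a measure \<Rightarrow> (real \<Rightarrow> 'a \<Rightarrow> real) \<Rightarrow> (real \<Rightarrow> real) measure" where
  "process_law M \<xi> = distr M (Pi\<^sub>M {0..} (\<lambda>_. borel)) (\<lambda>\<omega>. \<lambda>t\<in>{0..}. \<xi> t \<omega>)"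

definition dual_levy_process ::
  "'a measure \<Rightarrow> (real \<Rightarrow> 'a \<Rightarrow> real) \<Rightarrow> 'b measure \<Rightarrow> (real \<Rightarrow> 'b \<Rightarrow> real) \<Rightarrow> bool" where
  "dual_levy_process M \<xi> N \<xi>' \<longleftrightarrow>
     levy_process N \<xi>' \<and> process_law N \<xi>' = process_law M (\<lambda>t \<omega>. - \<xi> t \<omega>)"

text \<open>The next two integrals are Bochner integrals, so they would be \<open>0\<close> if divergent. The first is
  over a compact interval and always finite for a cadlag path; the second is almost surely finite
  for the dual of a process drifting to \<open>\<infinity>\<close>.\<close>

definition exp_clock :: "(real \<Rightarrow> 'a \<Rightarrow> real) \<Rightarrow> real \<Rightarrow> 'a \<Rightarrow> real" where
  "exp_clock \<xi> t \<omega> = (LINT s:{0..t}|lborel. exp (\<xi> s \<omega>))"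

definition exp_functional :: "(real \<Rightarrow> 'a \<Rightarrow> real) \<Rightarrow> 'a \<Rightarrow> real" where
  "exp_functional \<xi> \<omega> = (LINT s:{0..}|lborel. exp (\<xi> s \<omega>))"

text \<open>The inverse is meaningful on the almost sure event that the clock is a bijection of
  \<open>[0, \<infinity>)\<close>.\<close>

definition time_change :: "(real \<Rightarrow> 'a \<Rightarrow> real) \<Rightarrow> real \<Rightarrow> 'a \<Rightarrow> real" where
  "time_change \<xi> t \<omega> = the_inv_into {0..} (\<lambda>u. exp_clock \<xi> u \<omega>) t"

definition pssmp_one :: "(real \<Rightarrow> 'a \<Rightarrow> real) \<Rightarrow> real \<Rightarrow> 'a \<Rightarrow> real" where
  "pssmp_one \<xi> t \<omega> = exp (\<xi> (time_change \<xi> t \<omega>) \<omega>)"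

definition pssmp :: "(real \<Rightarrow> 'a \<Rightarrow> real) \<Rightarrow> real \<Rightarrow> real \<Rightarrow> 'a \<Rightarrow> real" where
  "pssmp \<xi> x t \<omega> = x * pssmp_one \<xi> (t / x) \<omega>"

definition OU_process :: "(real \<Rightarrow> 'a \<Rightarrow> real) \<Rightarrow> real \<Rightarrow> real \<Rightarrow> 'a \<Rightarrow> real" where
  "OU_process \<xi> x t \<omega> = exp (- t) * pssmp \<xi> x (exp t - 1) \<omega>"

definition measure_support :: "'a::topological_space measure \<Rightarrow> 'a set" where
  "measure_support \<mu> = {x. \<forall>V. open V \<longrightarrow> x \<in> V \<longrightarrow> emeasure \<mu> V > 0}"

end

theory Submission
  imports Defs
begin

text \<open>
  Put \<open>I(s) = \<integral>\<^sub>0\<^sup>s exp (\<xi>\<^sub>r) dr\<close>. At the time \<open>t = ln (1 + u I(s))\<close>, which the time change turns into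
  time \<open>s\<close> of \<open>\<xi>\<close>, the process \<open>U\<close> started from \<open>u\<close> has the reciprocal
  \<open>(1/u + I(s)) exp (- \<xi>\<^sub>s)\<close> (lemma \<open>OU_process_inverse\<close>). It is therefore enough that this
  quantity comes arbitrarily close to \<open>y = 1/x\<close> along integer times \<open>s = n\<close>.

  For \<open>k \<le> n\<close> consider the window \<open>W\<^sub>k\<^sub>,\<^sub>n = (I(n) - I(k)) exp (- \<xi>\<^sub>n)\<close>. Since \<open>\<xi>\<close> tends to infinity,
  changing \<open>k\<close>, or adding the term \<open>exp (- \<xi>\<^sub>n) / u\<close>, alters the sequence only by a null sequence
  in \<open>n\<close>. On the other hand \<open>W\<^sub>k\<^sub>,\<^sub>n\<close> depends only on the increments of \<open>\<xi>\<close> after time \<open>k\<close>. So the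
  event that \<open>W\<^sub>0\<^sub>,\<^sub>n\<close> returns near \<open>y\<close> infinitely often agrees almost surely with a tail event of the
  independent blocks of increments over \<open>[i, i + 1]\<close>, and its probability is 0 or 1 by Kolmogorov's
  law (lemma \<open>AE_recurs_near_window\<close>).

  It is not 0. Reversing time at \<open>n\<close> shows that \<open>W\<^sub>0\<^sub>,\<^sub>n\<close> has the law of
  \<open>\<integral>\<^sub>0\<^sup>n exp (\<xi>'\<^sub>r) dr\<close> for the dual process \<open>\<xi>'\<close> (lemmas \<open>same_law_right_sums\<close> and
  \<open>prob_exp_clock_le_window\<close>). These integrals increase to the exponential functional, whose law
  charges every neighbourhood of \<open>y\<close>; hence the probability that \<open>W\<^sub>0\<^sub>,\<^sub>n\<close> lies near \<open>y\<close> stays bounded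
  away from 0, and the reverse Fatou inequality \<open>prob_frequently_ge\<close> gives positive probability to
  infinitely many returns.

  Both the reversal and the measurability with respect to increments are obtained from Riemann sums
  over dyadic grids, which involve finitely many independent increments. Right end points are used
  because right-continuity then gives pointwise convergence everywhere, discontinuities of the path
  included.
\<close>

section \<open>Fatou-type estimates for events\<close>

text \<open>Reverse Fatou: the unions of the tails of \<open>A\<close> decrease to the event of infinitely many
  occurrences, and each of them has probability at least \<open>c\<close>.\<close>

lemma (in prob_space) prob_frequently_ge:
  assumes A [measurable]: "\<And>n. A n \<in> events"
    and freq: "\<exists>\<^sub>F n in sequentially. c \<le> prob (A n)"
  shows "c \<le> prob {\<omega>\<in>space M. \<exists>\<^sub>F n in sequentially. \<omega> \<in> A n}"
proof -
  define B where "B N = (\<Union>n\<in>{N..}. A n)" for N :: nat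
  have B: "B N \<in> events" for N
    unfolding B_def by auto
  have "decseq B"
    by (force simp: decseq_def B_def)
  then have lim: "(\<lambda>N. prob (B N)) \<longlonglongrightarrow> prob (\<Inter>N. B N)"
    using B by (intro finite_Lim_measure_decseq) auto
  have "(\<Inter>N. B N) = {\<omega>\<in>space M. \<exists>\<^sub>F n in sequentially. \<omega> \<in> A n}"
    using sets.sets_into_space[OF A] by (fastforce simp: B_def frequently_sequentially)
  moreover have "c \<le> prob (B N)" for N
  proof -
    obtain n where "n \<ge> N" "c \<le> prob (A n)"
      using freq by (auto simp: frequently_sequentially)
    then show ?thesis
      using finite_measure_mono[of "A n" "B N"] B by (force simp: B_def)
  qed
  ultimately show ?thesis
    using LIMSEQ_le_const[OF lim, of c] by auto
qed

text \<open>Fatou's lemma for events, by applying the reverse inequality to the complements of \<open>B n\<close>.\<close>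

lemma (in prob_space) eventually_prob_gt:
  assumes A [measurable]: "A \<in> events" "\<And>n. B n \<in> events"
    and sub: "AE \<omega> in M. \<omega> \<in> A \<longrightarrow> (\<forall>\<^sub>F n in sequentially. \<omega> \<in> B n)"
    and c: "c < prob A"
  shows "\<forall>\<^sub>F n in sequentially. c < prob (B n)"
proof (rule ccontr)
  assume "\<not> ?thesis"
  then have "\<exists>\<^sub>F n in sequentially. 1 - c \<le> prob (space M - B n)"
    by (simp add: not_eventually prob_compl not_less)
  then have "1 - c \<le> prob {\<omega>\<in>space M. \<exists>\<^sub>F n in sequentially. \<omega> \<in> space M - B n}"
    by (intro prob_frequently_ge) auto
  also have "\<dots> \<le> prob (space M - A)"
  proof (rule finite_measure_mono_AE)
    show "AE \<omega> in M. \<omega> \<in> {\<omega>\<in>space M. \<exists>\<^sub>F n in sequentially. \<omega> \<in> space M - B n}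
        \<longrightarrow> \<omega> \<in> space M - A"
      using sub by eventually_elim (auto simp: frequently_def elim: eventually_mono)
  qed auto
  also have "\<dots> = 1 - prob A"
    by (rule prob_compl) auto
  finally show False
    using c by simp
qed

text \<open>The two limits in fact have the same law. The one-sided comparison between an open set and a closed
  set containing it follows from the two Fatou inequalities alone, without weak convergence.\<close>

lemma prob_limit_le_of_same_law:
  fixes X :: "nat \<Rightarrow> 'a \<Rightarrow> real" and Y :: "nat \<Rightarrow> 'b \<Rightarrow> real"
  assumes "prob_space M" "prob_space N"
    and [measurable]: "\<And>m. X m \<in> borel_measurable M" "X' \<in> borel_measurable M"
    and [measurable]: "\<And>m. Y m \<in> borel_measurable N" "Y' \<in> borel_measurable N"
    and law: "\<And>m. distr M borel (X m) = distr N borel (Y m)"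
    and X: "AE \<omega> in M. (\<lambda>m. X m \<omega>) \<longlonglongrightarrow> X' \<omega>"
    and Y: "AE \<omega> in N. (\<lambda>m. Y m \<omega>) \<longlonglongrightarrow> Y' \<omega>"
    and U: "open U" and C: "closed C" and UC: "U \<subseteq> C"
  shows "measure N {\<omega>\<in>space N. Y' \<omega> \<in> U} \<le> measure M {\<omega>\<in>space M. X' \<omega> \<in> C}"
proof (rule dense_le)
  fix c assume c: "c < measure N {\<omega>\<in>space N. Y' \<omega> \<in> U}"
  interpret M: prob_space M by fact
  interpret N: prob_space N by fact
  have [measurable]: "U \<in> sets borel" "C \<in> sets borel"
    using U C by auto
  have "\<forall>\<^sub>F m in sequentially. c < measure N {\<omega>\<in>space N. Y m \<omega> \<in> U}"
  proof (rule N.eventually_prob_gt[OF _ _ _ c])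
    show "AE \<omega> in N. \<omega> \<in> {\<omega>\<in>space N. Y' \<omega> \<in> U} \<longrightarrow>
        (\<forall>\<^sub>F m in sequentially. \<omega> \<in> {\<omega>\<in>space N. Y m \<omega> \<in> U})"
      using Y by eventually_elim (use topological_tendstoD[OF _ U] in auto)
  qed auto
  moreover have "measure N {\<omega>\<in>space N. Y m \<omega> \<in> U} = measure M {\<omega>\<in>space M. X m \<omega> \<in> U}" for m
    using arg_cong[OF law[of m], of "\<lambda>D. measure D U"]
    by (simp add: measure_distr vimage_def Int_def conj_commute)
  ultimately have "\<forall>\<^sub>F m in sequentially. c \<le> measure M {\<omega>\<in>space M. X m \<omega> \<in> U}"
    by (auto elim: eventually_mono)
  then have "c \<le> measure M {\<omega>\<in>space M. \<exists>\<^sub>F m in sequentially. \<omega> \<in> {\<omega>\<in>space M. X m \<omega> \<in> U}}"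
    by (intro M.prob_frequently_ge eventually_frequently) auto
  also have "\<dots> \<le> measure M {\<omega>\<in>space M. X' \<omega> \<in> C}"
  proof (rule M.finite_measure_mono_AE)
    show "AE \<omega> in M. \<omega> \<in> {\<omega>\<in>space M. \<exists>\<^sub>F m in sequentially. \<omega> \<in> {\<omega>\<in>space M. X m \<omega> \<in> U}} \<longrightarrow>
        \<omega> \<in> {\<omega>\<in>space M. X' \<omega> \<in> C}"
      using X
    proof eventually_elim
      case (elim \<omega>)
      show ?case
      proof
        assume "\<omega> \<in> {\<omega>\<in>space M. \<exists>\<^sub>F m in sequentially. \<omega> \<in> {\<omega>\<in>space M. X m \<omega> \<in> U}}"
        then have \<omega>: "\<omega> \<in> space M" "\<exists>\<^sub>F m in sequentially. \<omega> \<in> {\<omega>\<in>space M. X m \<omega> \<in> U}"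
          by auto
        have "X' \<omega> \<in> C"
        proof (rule ccontr)
          assume "X' \<omega> \<notin> C"
          then have "\<forall>\<^sub>F m in sequentially. X m \<omega> \<in> - C"
            using topological_tendstoD[OF elim, of "- C"] C by auto
          then have "\<forall>\<^sub>F m in sequentially. \<not> (\<omega> \<in> {\<omega>\<in>space M. X m \<omega> \<in> U})"
            by (rule eventually_mono) (use UC in auto)
          with \<omega>(2) show False
            by (simp add: frequently_def)
        qed
        with \<omega>(1) show "\<omega> \<in> {\<omega>\<in>space M. X' \<omega> \<in> C}" by simp
      qed
    qed
  qed auto
  finally show "c \<le> measure M {\<omega>\<in>space M. X' \<omega> \<in> C}" .
qed

section \<open>Integrals of right-continuous paths with left limits\<close>

text \<open>The point of the grid of mesh \<open>2\<^sup>-\<^sup>m\<close> next to the right of \<open>s\<close>, strictly beyond \<open>s\<close> even if \<open>s\<close>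
  itself is on the grid, so that only right limits matter.\<close>

definition dyadic_right :: "nat \<Rightarrow> real \<Rightarrow> real" where
  "dyadic_right m s = real (nat \<lfloor>s * 2 ^ m\<rfloor> + 1) / 2 ^ m"

lemma dyadic_right_bounds:
  assumes "s \<ge> 0"
  shows "s < dyadic_right m s" "dyadic_right m s \<le> s + 1 / 2 ^ m"
proof -
  have "real (nat \<lfloor>s * 2 ^ m\<rfloor>) = of_int \<lfloor>s * 2 ^ m\<rfloor>"
    using assms by simp
  moreover have "of_int \<lfloor>s * 2 ^ m\<rfloor> \<le> s * 2 ^ m" "s * 2 ^ m < of_int \<lfloor>s * 2 ^ m\<rfloor> + 1"
    by linarith+
  ultimately show "s < dyadic_right m s" "dyadic_right m s \<le> s + 1 / 2 ^ m"
    unfolding dyadic_right_def by (simp_all add: field_simps)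
qed

lemma cadlag_dyadic_right:
  assumes f: "cadlag f" and s: "s \<ge> 0"
  shows "(\<lambda>m. f (dyadic_right m s)) \<longlonglongrightarrow> f s"
proof -
  have "(\<lambda>m. 1 / 2 ^ m :: real) \<longlonglongrightarrow> 0"
    by (rule LIMSEQ_divide_realpow_zero) auto
  then have "(\<lambda>m. s + 1 / 2 ^ m) \<longlonglongrightarrow> s"
    using tendsto_add[OF tendsto_const[of s]] by fastforce
  then have "(\<lambda>m. dyadic_right m s) \<longlonglongrightarrow> s"
    by (rule tendsto_sandwich[OF _ _ tendsto_const, rotated 2])
       (use dyadic_right_bounds[OF s] in \<open>auto intro!: always_eventually less_imp_le\<close>)
  then have "filterlim (\<lambda>m. dyadic_right m s) (at_right s) sequentially"
    using dyadic_right_bounds(1)[OF s]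
    by (auto simp: filterlim_at intro!: always_eventually less_imp_neq[symmetric])
  then show ?thesis
    using f s by (auto simp: cadlag_def intro: filterlim_compose)
qed

lemma cadlag_exp:
  assumes "cadlag f"
  shows "cadlag (\<lambda>t. exp (f t))"
  unfolding cadlag_def
proof (intro conjI allI impI)
  fix t :: real
  show "((\<lambda>t. exp (f t)) \<longlongrightarrow> exp (f t)) (at_right t)" if "t \<ge> 0"
    using assms that unfolding cadlag_def by (auto intro: tendsto_exp)
  show "\<exists>l. ((\<lambda>t. exp (f t)) \<longlongrightarrow> l) (at_left t)" if t: "t > 0"
  proof -
    obtain l where "(f \<longlongrightarrow> l) (at_left t)"
      using assms t unfolding cadlag_def by metis
    then show ?thesis
      using tendsto_exp by blast
  qed
qed

text \<open>The path at time \<open>s\<close> is the limit of its values at \<open>dyadic_right m s\<close>, and for fixed \<open>m\<close> those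
  points range over a countable grid.\<close>

lemma borel_measurable_cadlag_pair:
  fixes X :: "real \<Rightarrow> 'a \<Rightarrow> real"
  assumes X [measurable]: "\<And>t. t \<ge> 0 \<Longrightarrow> X t \<in> borel_measurable M"
    and cadlag: "\<And>\<omega>. \<omega> \<in> space M \<Longrightarrow> cadlag (\<lambda>t. X t \<omega>)"
  shows "(\<lambda>(\<omega>, s). indicator {0..} s * X s \<omega>) \<in> borel_measurable (M \<Otimes>\<^sub>M lborel)"
proof (rule borel_measurable_LIMSEQ_real)
  let ?F = "\<lambda>m (\<omega>, s). indicator {0..} s * X (dyadic_right m s) \<omega>"
  fix m
  have "(\<lambda>p. X (real (nat \<lfloor>snd p * (2::real) ^ m\<rfloor> + 1) / 2 ^ m) (fst p))
      \<in> borel_measurable (M \<Otimes>\<^sub>M lborel)"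
    by (rule measurable_compose_countable[where f = "\<lambda>i p. X (real (i + 1) / 2 ^ m) (fst p)"
          and g = "\<lambda>p. nat \<lfloor>snd p * (2::real) ^ m\<rfloor>"]) measurable
  then show "?F m \<in> borel_measurable (M \<Otimes>\<^sub>M lborel)"
    unfolding dyadic_right_def case_prod_beta by measurable
next
  fix p :: "'a \<times> real" assume "p \<in> space (M \<Otimes>\<^sub>M lborel)"
  then show "(\<lambda>m. (\<lambda>(\<omega>, s). indicator {0..} s * X (dyadic_right m s) \<omega>) p)
      \<longlonglongrightarrow> (\<lambda>(\<omega>, s). indicator {0..} s * X s \<omega>) p"
    using cadlag_dyadic_right[OF cadlag]
    by (auto simp: space_pair_measure indicator_def split: prod.splits)
qed

lemma cadlag_borel_measurable:
  assumes "cadlag f"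
  shows "(\<lambda>s. indicator {0..} s * f s) \<in> borel_measurable borel"
proof -
  have "(\<lambda>(\<omega>::unit, s). indicator {0..} s * f s) \<in> borel_measurable (count_space UNIV \<Otimes>\<^sub>M lborel)"
    by (rule borel_measurable_cadlag_pair) (use assms in auto)
  from measurable_compose[OF measurable_Pair1' this, of "()"] show ?thesis
    by simp
qed

text \<open>One-sided limits bound the path near each point, and \<open>[0, b]\<close> is compact.\<close>

lemma cadlag_bounded:
  assumes "cadlag f"
  obtains C where "\<And>s. 0 \<le> s \<Longrightarrow> s \<le> b \<Longrightarrow> \<bar>f s\<bar> \<le> C"
proof -
  have "\<exists>V C. open V \<and> t \<in> V \<and> (\<forall>s\<in>V. s \<ge> 0 \<longrightarrow> \<bar>f s\<bar> \<le> C)" if t: "t \<in> {0..b}" for t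
  proof -
    have "(f \<longlongrightarrow> f t) (at_right t)"
      using assms t by (auto simp: cadlag_def)
    from tendsto_rabs[OF this] have R: "\<forall>\<^sub>F s in at_right t. \<bar>f s\<bar> < \<bar>f t\<bar> + 1"
      by (rule order_tendstoD) simp
    obtain l where L: "\<forall>\<^sub>F s in at_left t. s \<ge> 0 \<longrightarrow> \<bar>f s\<bar> < l"
    proof (cases "t = 0")
      case True
      have "\<forall>\<^sub>F s in at_left t. s \<ge> 0 \<longrightarrow> \<bar>f s\<bar> < 0"
        using True eventually_at_left_real[of "-1" 0] by (auto elim: eventually_mono)
      then show ?thesis by (rule that)
    next
      case False
      with t have "t > 0" by simp
      then obtain l where "(f \<longlongrightarrow> l) (at_left t)"
        using assms unfolding cadlag_def by metis
      from tendsto_rabs[OF this] have "\<forall>\<^sub>F s in at_left t. \<bar>f s\<bar> < \<bar>l\<bar> + 1"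
        by (rule order_tendstoD) simp
      then have "\<forall>\<^sub>F s in at_left t. s \<ge> 0 \<longrightarrow> \<bar>f s\<bar> < \<bar>l\<bar> + 1"
        by (auto elim: eventually_mono)
      then show ?thesis by (rule that)
    qed
    let ?C = "max (\<bar>f t\<bar> + 1) l"
    have "\<forall>\<^sub>F s in at t. s \<ge> 0 \<longrightarrow> \<bar>f s\<bar> \<le> ?C"
      unfolding eventually_at_split using L R by (auto elim!: eventually_mono)
    then have "\<forall>\<^sub>F s in nhds t. s \<ge> 0 \<longrightarrow> \<bar>f s\<bar> \<le> ?C"
      by (auto simp: eventually_at_filter elim!: eventually_mono)
    then show ?thesis
      unfolding eventually_nhds by blast
  qed
  then obtain V C where V: "\<And>t. t \<in> {0..b} \<Longrightarrow> open (V t)" "\<And>t. t \<in> {0..b} \<Longrightarrow> t \<in> V t"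
      "\<And>t s. t \<in> {0..b} \<Longrightarrow> s \<in> V t \<Longrightarrow> s \<ge> 0 \<Longrightarrow> \<bar>f s\<bar> \<le> C t"
    by metis
  obtain K where K: "K \<subseteq> {0..b}" "finite K" "{0..b} \<subseteq> (\<Union>t\<in>K. V t)"
    by (rule compactE_image[of "{0..b}" "{0..b}" V]) (use V in auto)
  show thesis
  proof (rule that)
    fix s assume s: "0 \<le> s" "s \<le> b"
    then obtain t where "t \<in> K" "s \<in> V t"
      using K by auto
    then have "\<bar>f s\<bar> \<le> C t"
      using V(3)[of t s] K s by auto
    also have "\<dots> \<le> \<bar>C t\<bar>" by simp
    also have "\<dots> \<le> (\<Sum>t\<in>K. \<bar>C t\<bar>)"
      using K \<open>t \<in> K\<close> by (intro member_le_sum) auto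
    finally show "\<bar>f s\<bar> \<le> (\<Sum>t\<in>K. \<bar>C t\<bar>)" .
  qed
qed

definition right_sum :: "(real \<Rightarrow> real) \<Rightarrow> nat \<Rightarrow> nat \<Rightarrow> real" where
  "right_sum f n m = (\<Sum>j<n * 2 ^ m. f (real (j + 1) / 2 ^ m)) / 2 ^ m"

lemma cadlag_set_integrable:
  assumes "cadlag f"
  shows "set_integrable lborel {0..b} f"
  unfolding set_integrable_def
proof -
  obtain C where C: "\<And>s. 0 \<le> s \<Longrightarrow> s \<le> b \<Longrightarrow> \<bar>f s\<bar> \<le> C"
    using cadlag_bounded[OF assms] by metis
  note [measurable] = cadlag_borel_measurable[OF assms]
  have "(\<lambda>s. indicator {..b} s * (indicator {0..} s * f s)) \<in> borel_measurable lborel"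
    by measurable
  also have "(\<lambda>s. indicator {..b} s * (indicator {0..} s * f s)) = (\<lambda>s. indicator {0..b} s *\<^sub>R f s)"
    by (auto simp: indicator_def)
  finally show "integrable lborel (\<lambda>s. indicator {0..b} s *\<^sub>R f s)"
  proof (rule Bochner_Integration.integrable_bound[rotated])
    show "integrable lborel (\<lambda>s. indicator {0..b} s * C)"
      by (rule integrable_mult_left) (simp add: emeasure_lborel_Icc_eq)
    show "AE s in lborel. norm (indicator {0..b} s *\<^sub>R f s) \<le> norm (indicator {0..b} s * C)"
    proof (rule AE_I2)
      fix s
      show "norm (indicator {0..b} s *\<^sub>R f s) \<le> norm (indicator {0..b} s * C)"
        using C[of s] by (cases "s \<in> {0..b}") auto
    qed
  qed
qed

text \<open>The Riemann sum is the integral of the step function \<open>S m\<close>, which takes at \<open>s\<close> the value of the path at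
  \<open>dyadic_right m s\<close>; dominated convergence applies since the path is bounded. The convergence
  holds at every \<open>s\<close> of the half-open interval, the end point \<open>n\<close> being negligible.\<close>

lemma right_sum_tendsto:
  assumes f: "cadlag f"
  shows "(\<lambda>m. right_sum f n m) \<longlonglongrightarrow> (LINT s:{0..real n}|lborel. f s)"
proof -
  obtain C where C: "\<And>s. 0 \<le> s \<Longrightarrow> s \<le> real n + 1 \<Longrightarrow> \<bar>f s\<bar> \<le> C"
    using cadlag_bounded[OF f] by metis
  define S where "S m s = (\<Sum>j<n * 2 ^ m. indicator {real j / 2 ^ m..<real (j + 1) / 2 ^ m} s
      * f (real (j + 1) / 2 ^ m))" for m and s :: real
  have S: "S m s = indicator {0..<real n} s * f (dyadic_right m s)" for m s
  proof (cases "s \<in> {0..<real n}")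
    case True
    define k where "k = nat \<lfloor>s * 2 ^ m\<rfloor>"
    have k: "s \<in> {real j / 2 ^ m..<real (j + 1) / 2 ^ m} \<longleftrightarrow> j = k" for j
    proof -
      have "s \<in> {real j / 2 ^ m..<real (j + 1) / 2 ^ m} \<longleftrightarrow> real j \<le> s * 2 ^ m \<and> s * 2 ^ m < real j + 1"
        by (auto simp: field_simps)
      also have "\<dots> \<longleftrightarrow> j = k"
        using True floor_eq_iff[of "s * 2 ^ m" "int j"] unfolding k_def by auto
      finally show ?thesis .
    qed
    have "s * 2 ^ m < real n * 2 ^ m"
      using True by auto
    moreover have "real k \<le> s * 2 ^ m"
      using True unfolding k_def by simp
    ultimately have "real k < real n * 2 ^ m"
      by linarith
    then have "real k < real (n * 2 ^ m)"
      by simp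
    then have "k < n * 2 ^ m"
      using of_nat_less_iff by blast
    then show ?thesis
      using True unfolding S_def indicator_def k dyadic_right_def k_def[symmetric] by simp
  next
    case False
    have "s \<notin> {real j / 2 ^ m..<real (j + 1) / 2 ^ m}" if "j < n * 2 ^ m" for j
    proof
      assume *: "s \<in> {real j / 2 ^ m..<real (j + 1) / 2 ^ m}"
      have "real (j + 1) \<le> real (n * 2 ^ m)"
        using that by (intro of_nat_mono) auto
      then have "real (j + 1) / 2 ^ m \<le> real n"
        by (simp add: field_simps)
      moreover have "0 \<le> real j / 2 ^ m" by simp
      ultimately show False
        using * False unfolding atLeastLessThan_iff by linarith
    qed
    then have "S m s = 0"
      unfolding S_def by (intro sum.neutral) simp
    then show ?thesis
      using False by simp
  qed
  have int: "(LINT s|lborel. S m s) = right_sum f n m" for m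
  proof -
    have "(LINT s|lborel. S m s) = (\<Sum>j<n * 2 ^ m. LINT s|lborel.
        indicator {real j / 2 ^ m..<real (j + 1) / 2 ^ m} s * f (real (j + 1) / 2 ^ m))"
      unfolding S_def
      by (intro Bochner_Integration.integral_sum integrable_mult_left)
         (simp add: emeasure_lborel_Ico divide_right_mono)
    also have "\<dots> = (\<Sum>j<n * 2 ^ m. f (real (j + 1) / 2 ^ m) / 2 ^ m)"
    proof (rule sum.cong[OF refl])
      fix j
      have "measure lborel {real j / 2 ^ m..<real (j + 1) / 2 ^ m} = real (j + 1) / 2 ^ m - real j / 2 ^ m"
        by (rule measure_lborel_Ico) (simp add: divide_right_mono)
      then show "(LINT s|lborel. indicator {real j / 2 ^ m..<real (j + 1) / 2 ^ m} s
          * f (real (j + 1) / 2 ^ m)) = f (real (j + 1) / 2 ^ m) / 2 ^ m"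
        by (simp add: diff_divide_distrib[symmetric])
    qed
    finally show ?thesis
      by (simp add: right_sum_def sum_divide_distrib)
  qed
  note [measurable] = cadlag_borel_measurable[OF f]
  have "(\<lambda>s. indicator {..<real n} s * (indicator {0..} s * f s)) \<in> borel_measurable lborel"
    by measurable
  also have "(\<lambda>s. indicator {..<real n} s * (indicator {0..} s * f s))
      = (\<lambda>s. indicator {0..<real n} s * f s)"
    by (auto simp: indicator_def)
  finally have F [measurable]: "(\<lambda>s. indicator {0..<real n} s * f s) \<in> borel_measurable lborel" .
  have "(\<lambda>m. LINT s|lborel. S m s) \<longlonglongrightarrow> (LINT s|lborel. indicator {0..<real n} s * f s)"
  proof (rule integral_dominated_convergence)
    show "S m \<in> borel_measurable lborel" for m
      unfolding S_def by measurable
    show "integrable lborel (\<lambda>s. indicator {0..<real n} s * C)"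
      by (rule integrable_mult_left) simp
    show "AE s in lborel. (\<lambda>m. S m s) \<longlonglongrightarrow> indicator {0..<real n} s * f s"
      unfolding S using cadlag_dyadic_right[OF f] by (auto simp: indicator_def)
    show "AE s in lborel. norm (S m s) \<le> indicator {0..<real n} s * C" for m
    proof (rule AE_I2)
      fix s
      have "0 \<le> dyadic_right m s \<and> dyadic_right m s \<le> real n + 1" if s: "s \<in> {0..<real n}"
      proof -
        have "1 / 2 ^ m \<le> (1::real)" by simp
        then show ?thesis
          using s dyadic_right_bounds[of s m] unfolding atLeastLessThan_iff by linarith
      qed
      then show "norm (S m s) \<le> indicator {0..<real n} s * C"
        unfolding S using C by (auto simp: indicator_def)
    qed
  qed (fact F)
  also have "(LINT s|lborel. indicator {0..<real n} s * f s) = (LINT s:{0..real n}|lborel. f s)"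
    unfolding set_lebesgue_integral_def
  proof (rule integral_cong_AE)
    show "(\<lambda>s. indicator {0..real n} s *\<^sub>R f s) \<in> borel_measurable lborel"
      using cadlag_set_integrable[OF f] unfolding set_integrable_def by auto
    show "AE s in lborel. indicator {0..<real n} s * f s = indicator {0..real n} s *\<^sub>R f s"
      using AE_lborel_singleton[of "real n"] by eventually_elim (auto simp: indicator_def)
  qed (fact F)
  finally show ?thesis
    by (simp add: int)
qed

section \<open>Independence of the unit blocks of increments\<close>

locale levy =
  fixes M :: "'a measure" and \<xi> :: "real \<Rightarrow> 'a \<Rightarrow> real"
  assumes levy: "levy_process M \<xi>"

sublocale levy \<subseteq> prob_space M
  using levy by (simp add: levy_process_def)

context levy
begin

lemma measurable_\<xi> [measurable]: "t \<ge> 0 \<Longrightarrow> \<xi> t \<in> borel_measurable M"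
  using levy by (simp add: levy_process_def)

lemma cadlag_path: "\<omega> \<in> space M \<Longrightarrow> cadlag (\<lambda>t. \<xi> t \<omega>)"
  using levy by (simp add: levy_process_def)

lemma cadlag_exp_path: "\<omega> \<in> space M \<Longrightarrow> cadlag (\<lambda>t. exp (\<xi> t \<omega>))"
  using cadlag_path by (rule cadlag_exp)

definition increment :: "nat \<Rightarrow> nat \<Rightarrow> 'a \<Rightarrow> real" where
  "increment m l \<omega> = \<xi> (real (Suc l) / 2 ^ m) \<omega> - \<xi> (real l / 2 ^ m) \<omega>"

lemma measurable_increment [measurable]: "increment m l \<in> borel_measurable M"
  unfolding increment_def by measurable

lemma sum_increment:
  "i \<le> j \<Longrightarrow> (\<Sum>l\<in>{i..<j}. increment m l \<omega>) = \<xi> (real j / 2 ^ m) \<omega> - \<xi> (real i / 2 ^ m) \<omega>"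
  unfolding increment_def using sum_Suc_diff'[of i j "\<lambda>l. \<xi> (real l / 2 ^ m) \<omega>"] by simp

lemma distr_increment: "distr M borel (increment m l) = distr M borel (\<xi> (1 / 2 ^ m))"
proof -
  have "distr M borel (\<lambda>\<omega>. \<xi> (real l / 2 ^ m + 1 / 2 ^ m) \<omega> - \<xi> (real l / 2 ^ m) \<omega>)
      = distr M borel (\<xi> (1 / 2 ^ m))"
    using levy unfolding levy_process_def by simp
  then show ?thesis
    by (simp add: increment_def[abs_def] add_divide_distrib add.commute)
qed

lemma indep_vars_increment_lessThan: "indep_vars (\<lambda>_. borel) (increment m) {..<n}"
proof -
  have "0 \<le> t 0 \<and> (\<forall>i<n. t i \<le> t (Suc i)) \<longrightarrow>
      indep_vars (\<lambda>_. borel) (\<lambda>i \<omega>. \<xi> (t (Suc i)) \<omega> - \<xi> (t i) \<omega>) {..<n}" for t :: "nat \<Rightarrow> real"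
    using levy unfolding levy_process_def by simp
  from this[of "\<lambda>i. real i / 2 ^ m"] show ?thesis
    unfolding increment_def[abs_def] by (simp add: divide_right_mono)
qed

abbreviation increment_events :: "nat \<Rightarrow> nat \<Rightarrow> 'a set set" where
  "increment_events m l \<equiv> {increment m l -` B \<inter> space M |B. B \<in> sets borel}"

lemma indep_sets_increment: "indep_sets (increment_events m) UNIV"
proof (subst indep_sets_finite_index_sets, intro allI impI)
  fix J :: "nat set" assume "finite J"
  then have "J \<subseteq> {..<Suc (Max J)}"
    by (auto simp: less_Suc_eq_le)
  then show "indep_sets (increment_events m) J"
    using indep_vars_increment_lessThan[of m "Suc (Max J)"]
    unfolding indep_vars_def2 by (blast intro: indep_sets_mono_index)
qed

text \<open>The events determined by the increments of mesh \<open>2\<^sup>-\<^sup>m\<close> within \<open>[i, i + 1]\<close>.\<close>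

definition block :: "nat \<Rightarrow> nat \<Rightarrow> 'a set set" where
  "block m i = sigma_sets (space M) (\<Union>l\<in>{i * 2 ^ m..<Suc i * 2 ^ m}. increment_events m l)"

lemma sigma_algebra_block: "sigma_algebra (space M) (block m i)"
  unfolding block_def by (rule sigma_algebra_sigma_sets) auto

lemma indep_sets_block: "indep_sets (block m) UNIV"
  unfolding block_def
proof (rule indep_sets_collect_sigma)
  show "indep_sets (increment_events m) (\<Union>i\<in>UNIV. {i * 2 ^ m..<Suc i * 2 ^ m})"
    using indep_sets_increment by (rule indep_sets_mono_index[rotated]) auto
  show "Int_stable (increment_events m l)" for l
  proof (rule Int_stableI)
    fix A B assume "A \<in> increment_events m l" "B \<in> increment_events m l"
    then obtain A' B' where "A = increment m l -` A' \<inter> space M" "A' \<in> sets borel"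
        "B = increment m l -` B' \<inter> space M" "B' \<in> sets borel"
      by auto
    then show "A \<inter> B \<in> increment_events m l"
      by (intro CollectI exI[of _ "A' \<inter> B'"]) auto
  qed
  have "l \<in> {i * 2 ^ m..<Suc i * 2 ^ m} \<Longrightarrow> l div 2 ^ m = i" for l i :: nat
    by (rule div_nat_eqI) (auto simp: mult.commute)
  then show "disjoint_family_on (\<lambda>i. {i * 2 ^ m..<Suc i * 2 ^ m}) (UNIV :: nat set)"
    unfolding disjoint_family_on_def by blast
qed

lemma increment_events_subset_block:
  assumes "l \<in> {i * 2 ^ m..<Suc i * 2 ^ m}"
  shows "increment_events m l \<subseteq> block m i"
  using assms unfolding block_def by blast

lemma measurable_incrementI:
  assumes "sigma_algebra (space M) \<F>" "increment_events m l \<subseteq> \<F>"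
  shows "increment m l \<in> borel_measurable (sigma (space M) \<F>)"
proof (rule measurableI)
  interpret sigma_algebra "space M" \<F> by fact
  fix B :: "real set" assume "B \<in> sets borel"
  then show "increment m l -` B \<inter> space (sigma (space M) \<F>) \<in> sets (sigma (space M) \<F>)"
    using assms by auto
qed simp

text \<open>An increment over one cell is the sum of the increments over its two halves.\<close>

lemma block_subset_Suc: "block m i \<subseteq> block (Suc m) i"
proof -
  interpret S: sigma_algebra "space M" "block (Suc m) i"
    by (rule sigma_algebra_block)
  let ?S = "sigma (space M) (block (Suc m) i)"
  have "increment_events m l \<subseteq> block (Suc m) i" if l: "l \<in> {i * 2 ^ m..<Suc i * 2 ^ m}" for l
  proof -
    have "(2 * l) \<in> {i * 2 ^ Suc m..<Suc i * 2 ^ Suc m}" "Suc (2 * l) \<in> {i * 2 ^ Suc m..<Suc i * 2 ^ Suc m}"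
      using l by auto
    then have [measurable]: "increment (Suc m) (2 * l) \<in> borel_measurable ?S"
        "increment (Suc m) (Suc (2 * l)) \<in> borel_measurable ?S"
      using measurable_incrementI[OF S.sigma_algebra_axioms] increment_events_subset_block by blast+
    have "increment m l \<omega> = increment (Suc m) (2 * l) \<omega> + increment (Suc m) (Suc (2 * l)) \<omega>" for \<omega>
    proof -
      have "real (Suc (Suc (2 * l))) / 2 ^ Suc m = real (Suc l) / 2 ^ m"
           "real (2 * l) / 2 ^ Suc m = real l / 2 ^ m"
        by (simp_all add: field_simps)
      then show ?thesis
        unfolding increment_def by simp
    qed
    then have "increment m l \<in> borel_measurable ?S"
      by (subst measurable_cong[where g = "\<lambda>\<omega>. increment (Suc m) (2 * l) \<omega> + increment (Suc m) (Suc (2 * l)) \<omega>"])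
         measurable
    from measurable_sets[OF this] show ?thesis
      by auto
  qed
  then show ?thesis
    unfolding block_def[of m] by (intro S.sigma_sets_subset) blast
qed

lemma block_mono: "m \<le> m' \<Longrightarrow> block m i \<subseteq> block m' i"
  by (rule lift_Suc_mono_le[of "\<lambda>m. block m i"]) (rule block_subset_Suc)

definition unit_block :: "nat \<Rightarrow> 'a set set" where
  "unit_block i = sigma_sets (space M) (\<Union>m. block m i)"

lemma block_subset_Pow: "(\<Union>m. block m i) \<subseteq> Pow (space M)"
  using sigma_algebra.axioms(1)[OF sigma_algebra_block] sigma_algebra_block
  by (meson UN_least algebra.axioms(1) ring_of_sets.axioms(1) semiring_of_sets.axioms(1) subset_class.space_closed)

lemma sigma_algebra_unit_block: "sigma_algebra (space M) (unit_block i)"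
  unfolding unit_block_def by (rule sigma_algebra_sigma_sets) (rule block_subset_Pow)

text \<open>Finitely many events of the unions of the \<open>block m i\<close> over \<open>m\<close> all belong to the blocks of one common
  mesh, where independence is known. As the blocks increase with \<open>m\<close>, the unions are closed under
  intersection, so independence passes to the generated \<open>\<sigma>\<close>-algebras.\<close>

lemma indep_sets_unit_block: "indep_sets unit_block UNIV"
  unfolding unit_block_def
proof (rule indep_sets_sigma)
  show "indep_sets (\<lambda>i. \<Union>m. block m i) UNIV"
  proof (rule indep_setsI)
    show "(\<Union>m. block m i) \<subseteq> events" for i
      using indep_sets_block by (auto simp: indep_sets_def)
    fix A J assume J: "J \<noteq> {}" "finite (J :: nat set)" and A: "\<forall>j\<in>J. A j \<in> (\<Union>m. block m j)"
    then obtain m where m: "\<And>j. j \<in> J \<Longrightarrow> A j \<in> block (m j) j"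
      by (auto simp: bchoice_iff)
    have "A j \<in> block (Max (m ` J)) j" if "j \<in> J" for j
      using m[OF that] block_mono[of "m j" "Max (m ` J)" j] J that by auto
    then show "prob (\<Inter>j\<in>J. A j) = (\<Prod>j\<in>J. prob (A j))"
      using indep_setsD[OF indep_sets_block[of "Max (m ` J)"], of J A] J by auto
  qed
  show "Int_stable (\<Union>m. block m i)" for i
  proof (rule Int_stableI)
    fix A B assume "A \<in> (\<Union>m. block m i)" "B \<in> (\<Union>m. block m i)"
    then obtain m n where AB: "A \<in> block m i" "B \<in> block n i"
      by auto
    interpret sigma_algebra "space M" "block (max m n) i"
      by (rule sigma_algebra_block)
    from AB have "A \<in> block (max m n) i" "B \<in> block (max m n) i"
      using block_mono[of m "max m n" i] block_mono[of n "max m n" i] by auto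
    then show "A \<inter> B \<in> (\<Union>m. block m i)"
      by auto
  qed
qed

definition future :: "nat \<Rightarrow> 'a measure" where
  "future k = sigma (space M) (\<Union>i\<in>{k..}. unit_block i)"

lemma unit_block_subset_Pow: "unit_block i \<subseteq> Pow (space M)"
  unfolding unit_block_def using sigma_sets_into_sp[OF block_subset_Pow] by auto

lemma space_future [simp]: "space (future k) = space M"
  unfolding future_def by (rule space_measure_of) (use unit_block_subset_Pow in blast)

lemma sets_future: "sets (future k) = sigma_sets (space M) (\<Union>i\<in>{k..}. unit_block i)"
  unfolding future_def by (rule sets_measure_of) (use unit_block_subset_Pow in blast)

lemma sets_future_antimono: "k \<le> k' \<Longrightarrow> sets (future k') \<subseteq> sets (future k)"
  unfolding sets_future by (intro sigma_sets_subseteq UN_mono) auto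

lemma sets_future_subset_events: "sets (future k) \<subseteq> events"
  unfolding sets_future
  using indep_sets_unit_block by (intro sets.sigma_sets_subset) (auto simp: indep_sets_def)

lemma measurable_increment_future:
  assumes "k * 2 ^ m \<le> l"
  shows "increment m l \<in> borel_measurable (future k)"
proof (rule measurableI)
  let ?i = "l div 2 ^ m"
  fix B :: "real set" assume "B \<in> sets borel"
  then have "increment m l -` B \<inter> space M \<in> increment_events m l"
    by blast
  moreover have "l \<in> {?i * 2 ^ m..<Suc ?i * 2 ^ m}"
    using dividend_less_div_times[of "2 ^ m" l] by (simp add: add.commute)
  ultimately have "increment m l -` B \<inter> space M \<in> block m ?i"
    using increment_events_subset_block by blast
  moreover have "k \<le> ?i"
    using assms by (simp add: less_eq_div_iff_mult_less_eq)
  ultimately show "increment m l -` B \<inter> space (future k) \<in> sets (future k)"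
    unfolding sets_future space_future unit_block_def by (intro sigma_sets.Basic) blast
qed simp

section \<open>The zero-one law for limit points of the normalised clock\<close>

text \<open>This is \<open>\<integral>\<^sub>k\<^sup>n exp (\<xi>\<^sub>r - \<xi>\<^sub>n) dr\<close>, written through the clock so that a change of \<open>k\<close> only changes a
  factor of \<open>exp (- \<xi>\<^sub>n)\<close> that is constant in \<open>n\<close>.\<close>

definition window :: "nat \<Rightarrow> nat \<Rightarrow> 'a \<Rightarrow> real" where
  "window k n \<omega> = (exp_clock \<xi> n \<omega> - exp_clock \<xi> k \<omega>) * exp (- \<xi> n \<omega>)"

lemma right_sum_tendsto_exp_clock:
  assumes "\<omega> \<in> space M"
  shows "(\<lambda>m. right_sum (\<lambda>s. exp (\<xi> s \<omega>)) n m) \<longlonglongrightarrow> exp_clock \<xi> n \<omega>"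
  using right_sum_tendsto[OF cadlag_exp_path[OF assms]] by (simp add: exp_clock_def)

lemma exp_clock_0:
  assumes "\<omega> \<in> space M" shows "exp_clock \<xi> 0 \<omega> = 0"
  using LIMSEQ_unique[OF right_sum_tendsto_exp_clock[OF assms, of 0]] by (simp add: right_sum_def)

text \<open>In the Riemann sums of the window, \<open>\<xi>\<^sub>r - \<xi>\<^sub>n\<close> at a grid point \<open>r > k\<close> is minus the sum of the increments
  from \<open>r\<close> to \<open>n\<close>, all of which are after time \<open>k\<close>.\<close>

lemma measurable_window_future:
  assumes "k \<le> n"
  shows "window k n \<in> borel_measurable (future k)"
proof (rule borel_measurable_LIMSEQ_real)
  fix \<omega> assume "\<omega> \<in> space (future k)"
  then show "(\<lambda>m. (right_sum (\<lambda>s. exp (\<xi> s \<omega>)) n m - right_sum (\<lambda>s. exp (\<xi> s \<omega>)) k m) * exp (- \<xi> n \<omega>))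
      \<longlonglongrightarrow> window k n \<omega>"
    unfolding window_def by (intro tendsto_intros right_sum_tendsto_exp_clock) auto
next
  fix m
  have eq: "(right_sum (\<lambda>s. exp (\<xi> s \<omega>)) n m - right_sum (\<lambda>s. exp (\<xi> s \<omega>)) k m) * exp (- \<xi> n \<omega>)
    = (\<Sum>j\<in>{k * 2 ^ m..<n * 2 ^ m}. exp (- (\<Sum>l\<in>{Suc j..<n * 2 ^ m}. increment m l \<omega>))) / 2 ^ m" for \<omega>
  proof -
    have "right_sum (\<lambda>s. exp (\<xi> s \<omega>)) n m - right_sum (\<lambda>s. exp (\<xi> s \<omega>)) k m
        = (\<Sum>j\<in>{k * 2 ^ m..<n * 2 ^ m}. exp (\<xi> (real (Suc j) / 2 ^ m) \<omega>)) / 2 ^ m"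
      using sum_diff_nat_ivl[of 0 "k * 2 ^ m" "n * 2 ^ m" "\<lambda>j. exp (\<xi> (real (Suc j) / 2 ^ m) \<omega>)"] assms
      unfolding right_sum_def by (simp add: lessThan_atLeast0 diff_divide_distrib[symmetric])
    moreover have "exp (\<xi> (real (Suc j) / 2 ^ m) \<omega>) * exp (- \<xi> n \<omega>)
        = exp (- (\<Sum>l\<in>{Suc j..<n * 2 ^ m}. increment m l \<omega>))" if "j < n * 2 ^ m" for j
      using that by (subst sum_increment) (auto simp: exp_add[symmetric])
    ultimately show ?thesis
      by (simp add: sum_distrib_right)
  qed
  show "(\<lambda>\<omega>. (right_sum (\<lambda>s. exp (\<xi> s \<omega>)) n m - right_sum (\<lambda>s. exp (\<xi> s \<omega>)) k m) * exp (- \<xi> n \<omega>))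
      \<in> borel_measurable (future k)"
    unfolding eq
    by (intro borel_measurable_divide borel_measurable_sum borel_measurable_exp[THEN measurable_compose[rotated]]
        borel_measurable_uminus measurable_increment_future borel_measurable_const) auto
qed

lemma measurable_window [measurable]: "k \<le> n \<Longrightarrow> window k n \<in> borel_measurable M"
  using measurable_window_future sets_future_subset_events[of k]
  by (auto simp: measurable_def)

end
text \<open>The slack \<open>1/(j + 1)\<close> makes the property stable under perturbations tending to 0; it holds as soon as
  \<open>a\<close> visits the closed ball of radius \<open>c\<close> infinitely often.\<close>

definition recurs_near :: "real \<Rightarrow> real \<Rightarrow> (nat \<Rightarrow> real) \<Rightarrow> bool" where
  "recurs_near y c a \<longleftrightarrow> (\<forall>j. \<exists>\<^sub>F n in sequentially. \<bar>a n - y\<bar> < c + 1 / real (Suc j))"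


lemma recurs_near_perturb:
  assumes a: "recurs_near y c a" and ab: "(\<lambda>n. a n - b n) \<longlonglongrightarrow> 0"
  shows "recurs_near y c b"
  unfolding recurs_near_def
proof
  fix j
  let ?d = "1 / real (Suc j) - 1 / real (Suc (Suc j))"
  have "?d > 0"
    by (simp add: frac_less2)
  then have "\<forall>\<^sub>F n in sequentially. \<bar>a n - b n\<bar> < ?d"
    using order_tendstoD(2)[OF tendsto_rabs[OF ab], of ?d] by simp
  moreover have "\<exists>\<^sub>F n in sequentially. \<bar>a n - y\<bar> < c + 1 / real (Suc (Suc j))"
    using a unfolding recurs_near_def by blast
  ultimately have "\<exists>\<^sub>F n in sequentially. \<bar>a n - y\<bar> < c + 1 / real (Suc (Suc j)) \<and> \<bar>a n - b n\<bar> < ?d"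
    by (simp add: frequently_eventually_frequently)
  then show "\<exists>\<^sub>F n in sequentially. \<bar>b n - y\<bar> < c + 1 / real (Suc j)"
    by (rule frequently_elim1) linarith
qed

context levy
begin

lemma sets_recurs_near_window:
  "{\<omega>\<in>space M. recurs_near y c (\<lambda>n. window k n \<omega>)} \<in> sets (future k)"
proof -
  \<comment> \<open>Times \<open>n < k\<close> are cut off because the window is measurable for the future of \<open>k\<close> only from time \<open>k\<close> on.\<close>
  have iff: "recurs_near y c a \<longleftrightarrow> (\<forall>j N. \<exists>n\<in>{max N k..}. \<bar>a n - y\<bar> < c + 1 / real (Suc j))" for a
    unfolding recurs_near_def frequently_sequentially
    by (meson atLeast_iff max.bounded_iff max.cobounded1)
  have [measurable]: "n \<in> {max N k..} \<Longrightarrow> window k n \<in> borel_measurable (future k)" for N n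
    by (rule measurable_window_future) simp
  have "Measurable.pred (future k)
      (\<lambda>\<omega>. \<forall>j N. \<exists>n\<in>{max N k..}. \<bar>window k n \<omega> - y\<bar> < c + 1 / real (Suc j))"
    by measurable
  then show ?thesis
    unfolding iff pred_def by simp
qed

text \<open>The event \<open>E k\<close> of recurrence of the windows from \<open>k\<close> belongs to the future of \<open>k\<close>, and all the events
  \<open>E k\<close> coincide on the paths that tend to infinity. Their upper limit \<open>T\<close> is a genuine tail event
  that agrees almost surely with \<open>E 0\<close>; the zero-one law is applied to it, since \<open>E 0\<close> itself need not
  be a tail event.\<close>

lemma AE_recurs_near_window:
  assumes drift: "drifts_to_infinity M \<xi>" and "\<delta> > 0"
    and freq: "\<exists>\<^sub>F n in sequentially. \<delta> \<le> prob {\<omega>\<in>space M. \<bar>window 0 n \<omega> - y\<bar> \<le> c}"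
  shows "AE \<omega> in M. recurs_near y c (\<lambda>n. window 0 n \<omega>)"
proof -
  define E where "E k = {\<omega>\<in>space M. recurs_near y c (\<lambda>n. window k n \<omega>)}" for k
  define T where "T = (\<Inter>K. \<Union>k\<in>{K..}. E k)"
  have E [measurable]: "E k \<in> events" for k
    using sets_recurs_near_window sets_future_subset_events unfolding E_def by blast
  have "T \<in> sets (future K)" for K
  proof -
    have "T = (\<Inter>L\<in>{K..}. \<Union>k\<in>{L..}. E k)"
    proof -
      have "\<omega> \<in> T" if "\<omega> \<in> (\<Inter>L\<in>{K..}. \<Union>k\<in>{L..}. E k)" for \<omega>
        unfolding T_def
      proof
        fix L
        have "\<omega> \<in> (\<Union>k\<in>{max K L..}. E k)"
          using that by (rule INT_D) simp
        then show "\<omega> \<in> (\<Union>k\<in>{L..}. E k)" by auto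
      qed
      then show ?thesis
        unfolding T_def by blast
    qed
    moreover have "E k \<in> sets (future K)" if "K \<le> k" for k
      using sets_recurs_near_window sets_future_antimono[OF that] unfolding E_def by blast
    ultimately show ?thesis
      by (auto intro!: sets.countable_INT' sets.countable_UN')
  qed
  then have T_tail: "T \<in> tail_events unit_block"
    unfolding tail_events_def sets_future by auto
  have [measurable]: "T \<in> events"
    unfolding T_def by measurable
  have T_iff: "AE \<omega> in M. \<omega> \<in> T \<longleftrightarrow> \<omega> \<in> E 0"
    using drift[unfolded drifts_to_infinity_def] AE_space
  proof eventually_elim
    case (elim \<omega>)
    have "filterlim (\<lambda>n. \<xi> (real n) \<omega>) at_top sequentially"
      using elim(1) filterlim_real_sequentially by (rule filterlim_compose)
    then have "filterlim (\<lambda>n. - \<xi> (real n) \<omega>) at_bot sequentially"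
      by (simp add: filterlim_uminus_at_bot)
    then have exp0: "(\<lambda>n. exp (- \<xi> (real n) \<omega>)) \<longlonglongrightarrow> 0"
      by (rule filterlim_compose[OF exp_at_bot])
    have "(\<lambda>n. window k n \<omega> - window k' n \<omega>) \<longlonglongrightarrow> 0" for k k'
      using tendsto_mult_right_zero[OF exp0, of "exp_clock \<xi> k' \<omega> - exp_clock \<xi> k \<omega>"]
      unfolding window_def by (simp add: algebra_simps)
    then have "\<omega> \<in> E k \<longleftrightarrow> \<omega> \<in> E 0" for k
      using elim(2) unfolding E_def by (auto intro: recurs_near_perturb)
    then show ?case
      unfolding T_def by auto
  qed
  have "\<delta> \<le> prob {\<omega>\<in>space M. \<exists>\<^sub>F n in sequentially. \<omega> \<in> {\<omega>\<in>space M. \<bar>window 0 n \<omega> - y\<bar> \<le> c}}"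
    by (rule prob_frequently_ge[OF _ freq]) measurable
  also have "\<dots> \<le> prob (E 0)"
  proof (rule finite_measure_mono)
    show "{\<omega>\<in>space M. \<exists>\<^sub>F n in sequentially. \<omega> \<in> {\<omega>\<in>space M. \<bar>window 0 n \<omega> - y\<bar> \<le> c}} \<subseteq> E 0"
      unfolding E_def recurs_near_def
      by (auto elim!: frequently_elim1 intro: le_less_trans)
  qed simp
  also have "prob (E 0) = prob T"
    by (rule finite_measure_eq_AE) (use T_iff in auto)
  finally have "prob T = 1"
    using kolmogorov_0_1_law[OF sigma_algebra_unit_block indep_sets_unit_block T_tail] \<open>\<delta> > 0\<close>
    by linarith
  then have "AE \<omega> in M. \<omega> \<in> T"
    by (simp add: prob_eq_1)
  with T_iff show ?thesis
    by eventually_elim (simp add: E_def)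
qed

end

section \<open>Time reversal\<close>

lemma sum_lessThan_reflect:
  "(\<Sum>i<l. d (K - Suc i)) = (\<Sum>i\<in>{K - l..<K}. d i)" if "l \<le> K" for d :: "nat \<Rightarrow> real"
  using that by (intro sum.reindex_bij_witness[where i = "\<lambda>i. K - Suc i" and j = "\<lambda>i. K - Suc i"]) auto

text \<open>Let \<open>K = n 2\<^sup>m\<close>. The increments of the dual process on the grid are \<open>K\<close> independent variables with the
  law of \<open>- \<xi>\<close> at the mesh size, and so are the increments of \<open>- \<xi>\<close> read backwards from time \<open>n\<close>. Both
  sides are the same function \<open>\<Phi>\<close> of these two sequences. Reading backwards exchanges left and
  right end points, so right sums for \<open>\<xi>\<close> correspond to left sums for the dual process.\<close>

lemma same_law_right_sums:
  assumes xi: "levy_process M \<xi>" and dual: "dual_levy_process M \<xi> N \<xi>'"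
  shows "distr M borel (\<lambda>\<omega>. right_sum (\<lambda>s. exp (\<xi> s \<omega>)) n m * exp (- \<xi> n \<omega>))
    = distr N borel (\<lambda>\<omega>. (\<Sum>l<n * 2 ^ m. exp (\<xi>' (real l / 2 ^ m) \<omega>)) / 2 ^ m)"
proof (cases "n = 0")
  case True
  interpret M: levy M \<xi> by unfold_locales fact
  interpret N: levy N \<xi>' by unfold_locales (use dual in \<open>simp add: dual_levy_process_def\<close>)
  show ?thesis
    using True M.prob_space_axioms N.prob_space_axioms
    by (simp add: right_sum_def M.distr_const N.distr_const)
next
  case False
  interpret M: levy M \<xi> by unfold_locales fact
  interpret N: levy N \<xi>' by unfold_locales (use dual in \<open>simp add: dual_levy_process_def\<close>)
  define K where "K = n * 2 ^ m"
  have K: "{..<K} \<noteq> {}"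
    using False by (auto simp: K_def lessThan_empty_iff)
  define \<nu> where "\<nu> = distr N borel (\<xi>' (1 / 2 ^ m))"
  define \<Phi> where "\<Phi> d = (\<Sum>l<K. exp (\<Sum>i<l. d i)) / 2 ^ m" for d :: "nat \<Rightarrow> real"
  define P where "P = Pi\<^sub>M {..<K} (\<lambda>_. borel :: real measure)"
  have \<Phi> [measurable]: "\<Phi> \<in> borel_measurable P"
    unfolding \<Phi>_def[abs_def] P_def by measurable
  have \<nu>: "distr M borel (\<lambda>\<omega>. - M.increment m l \<omega>) = \<nu>" for l
  proof -
    let ?h = "1 / 2 ^ m :: real"
    have "distr M borel (\<lambda>\<omega>. - M.increment m l \<omega>) = distr (distr M borel (M.increment m l)) borel uminus"
      by (subst distr_distr) (auto simp: comp_def)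
    also have "\<dots> = distr M borel (\<lambda>\<omega>. - \<xi> ?h \<omega>)"
      unfolding M.distr_increment by (subst distr_distr) (auto simp: comp_def)
    also have "\<dots> = distr (process_law M (\<lambda>t \<omega>. - \<xi> t \<omega>)) borel (\<lambda>f. f ?h)"
      unfolding process_law_def
      by (subst distr_distr) (auto simp: comp_def intro!: measurable_restrict)
    also have "process_law M (\<lambda>t \<omega>. - \<xi> t \<omega>) = process_law N \<xi>'"
      using dual by (simp add: dual_levy_process_def)
    also have "distr (process_law N \<xi>') borel (\<lambda>f. f ?h) = \<nu>"
      unfolding process_law_def \<nu>_def
      by (subst distr_distr) (auto simp: comp_def intro!: measurable_restrict)
    finally show ?thesis .
  qed
  have "M.indep_vars (\<lambda>_. borel) (\<lambda>l \<omega>. - M.increment m l \<omega>) {..<K}"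
    by (rule M.indep_vars_compose2[OF M.indep_vars_increment_lessThan]) auto
  then have lawM: "distr M P (\<lambda>\<omega>. \<lambda>l\<in>{..<K}. - M.increment m l \<omega>) = (\<Pi>\<^sub>M i\<in>{..<K}. \<nu>)"
    unfolding P_def using K by (subst (asm) M.indep_vars_iff_distr_eq_PiM) (auto simp: \<nu>)
  have lawN: "distr N P (\<lambda>\<omega>. \<lambda>l\<in>{..<K}. N.increment m l \<omega>) = (\<Pi>\<^sub>M i\<in>{..<K}. \<nu>)"
    unfolding P_def using N.indep_vars_increment_lessThan[of m K] K
    by (subst (asm) N.indep_vars_iff_distr_eq_PiM) (auto simp: N.distr_increment \<nu>_def)
  have sets_PiM_\<nu> [measurable_cong]: "sets (\<Pi>\<^sub>M i\<in>{..<K}. \<nu>) = sets P"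
    unfolding P_def \<nu>_def by (intro sets_PiM_cong) auto
  \<comment> \<open>An i.i.d. sequence keeps its law under the reversal \<open>\<rho>\<close>.\<close>
  define \<rho> where "\<rho> d = (\<lambda>i\<in>{..<K}. d (K - Suc i))" for d :: "nat \<Rightarrow> real"
  have \<rho> [measurable]: "\<rho> \<in> measurable P P"
    unfolding P_def \<rho>_def[abs_def] by (intro measurable_restrict measurable_component_singleton) auto
  have prob_\<nu>: "prob_space \<nu>"
    unfolding \<nu>_def by (intro N.prob_space_distr) auto
  have "distr (\<Pi>\<^sub>M i\<in>{..<K}. \<nu>) (\<Pi>\<^sub>M i\<in>{..<K}. \<nu>) \<rho> = (\<Pi>\<^sub>M i\<in>{..<K}. \<nu>)"
    unfolding \<rho>_def[abs_def] using prob_\<nu>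
    by (intro distr_PiM_reindex[where f = "\<lambda>i. K - Suc i" and M = "\<lambda>_. \<nu>"]) (auto simp: inj_on_def)
  moreover have "distr (\<Pi>\<^sub>M i\<in>{..<K}. \<nu>) (\<Pi>\<^sub>M i\<in>{..<K}. \<nu>) \<rho> = distr (\<Pi>\<^sub>M i\<in>{..<K}. \<nu>) P \<rho>"
    by (rule distr_cong[OF refl sets_PiM_\<nu> refl])
  ultimately have rev: "distr (\<Pi>\<^sub>M i\<in>{..<K}. \<nu>) P \<rho> = (\<Pi>\<^sub>M i\<in>{..<K}. \<nu>)" by simp
  have mM [measurable]: "(\<lambda>\<omega>. \<lambda>l\<in>{..<K}. - M.increment m l \<omega>) \<in> measurable M P"
    unfolding P_def by measurable
  have mN [measurable]: "(\<lambda>\<omega>. \<lambda>l\<in>{..<K}. N.increment m l \<omega>) \<in> measurable N P"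
    unfolding P_def by measurable
  have K_h: "real K / 2 ^ m = real n"
    by (simp add: K_def)
  have "right_sum (\<lambda>s. exp (\<xi> s \<omega>)) n m * exp (- \<xi> n \<omega>)
      = \<Phi> (\<rho> (\<lambda>l\<in>{..<K}. - M.increment m l \<omega>))" for \<omega>
  proof -
    have "(\<Sum>i<l. \<rho> (\<lambda>l\<in>{..<K}. - M.increment m l \<omega>) i)
        = \<xi> (real (K - l) / 2 ^ m) \<omega> - \<xi> n \<omega>" if "l < K" for l
    proof -
      have "(\<Sum>i<l. \<rho> (\<lambda>l\<in>{..<K}. - M.increment m l \<omega>) i) = (\<Sum>i<l. - M.increment m (K - Suc i) \<omega>)"
        using that by (intro sum.cong) (auto simp: \<rho>_def)
      also have "\<dots> = - (\<Sum>i\<in>{K - l..<K}. M.increment m i \<omega>)"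
        using that by (subst sum_lessThan_reflect) (auto simp: sum_negf)
      finally show ?thesis
        by (simp add: M.sum_increment K_h)
    qed
    then have "\<Phi> (\<rho> (\<lambda>l\<in>{..<K}. - M.increment m l \<omega>))
        = (\<Sum>l<K. exp (\<xi> (real (K - l) / 2 ^ m) \<omega>)) * exp (- \<xi> n \<omega>) / 2 ^ m"
      unfolding \<Phi>_def sum_distrib_right by (simp add: exp_diff exp_minus divide_inverse)
    also have "(\<Sum>l<K. exp (\<xi> (real (K - l) / 2 ^ m) \<omega>)) = (\<Sum>j<K. exp (\<xi> (real (Suc j) / 2 ^ m) \<omega>))"
      by (intro sum.reindex_bij_witness[where i = "\<lambda>i. K - Suc i" and j = "\<lambda>i. K - Suc i"])
         (auto simp: Suc_diff_Suc)
    finally show ?thesis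
      unfolding right_sum_def K_def[symmetric] by (simp only: Suc_eq_plus1 times_divide_eq_left)
  qed
  then have "distr M borel (\<lambda>\<omega>. right_sum (\<lambda>s. exp (\<xi> s \<omega>)) n m * exp (- \<xi> n \<omega>))
      = distr (distr (distr M P (\<lambda>\<omega>. \<lambda>l\<in>{..<K}. - M.increment m l \<omega>)) P \<rho>) borel \<Phi>"
    by (simp add: distr_distr comp_def)
  also have "\<dots> = distr (distr N P (\<lambda>\<omega>. \<lambda>l\<in>{..<K}. N.increment m l \<omega>)) borel \<Phi>"
    unfolding lawM lawN rev ..
  also have "\<dots> = distr N borel (\<lambda>\<omega>. \<Phi> (\<lambda>l\<in>{..<K}. N.increment m l \<omega>))"
    by (simp add: distr_distr comp_def)
  also have "\<dots> = distr N borel (\<lambda>\<omega>. (\<Sum>l<n * 2 ^ m. exp (\<xi>' (real l / 2 ^ m) \<omega>)) / 2 ^ m)"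
  proof (rule distr_cong_AE)
    have "AE \<omega> in N. \<xi>' 0 \<omega> = 0"
      using N.levy by (simp add: levy_process_def)
    then show "AE \<omega> in N. \<Phi> (\<lambda>l\<in>{..<K}. N.increment m l \<omega>)
        = (\<Sum>l<n * 2 ^ m. exp (\<xi>' (real l / 2 ^ m) \<omega>)) / 2 ^ m"
    proof eventually_elim
      case (elim \<omega>)
      have "(\<Sum>i<l. (\<lambda>l\<in>{..<K}. N.increment m l \<omega>) i) = \<xi>' (real l / 2 ^ m) \<omega>" if "l < K" for l
      proof -
        have "(\<Sum>i<l. (\<lambda>l\<in>{..<K}. N.increment m l \<omega>) i) = (\<Sum>i\<in>{0..<l}. N.increment m i \<omega>)"
          using that by (intro sum.cong) auto
        then show ?thesis
          using elim by (simp add: N.sum_increment)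
      qed
      then show ?case
        unfolding \<Phi>_def K_def[symmetric] by simp
    qed
  qed (auto)
  finally show ?thesis .
qed

text \<open>Left and right Riemann sums differ by the boundary term \<open>(exp (\<xi>'\<^sub>0) - exp (\<xi>'\<^sub>n)) / 2\<^sup>m\<close>, which vanishes
  in the limit; so both sums of \<open>same_law_right_sums\<close> converge to the respective integrals.\<close>

lemma prob_exp_clock_le_window:
  assumes xi: "levy_process M \<xi>" and dual: "dual_levy_process M \<xi> N \<xi>'"
    and U: "open U" and C: "closed C" and UC: "U \<subseteq> C"
  shows "measure N {\<omega>\<in>space N. exp_clock \<xi>' (real n) \<omega> \<in> U}
    \<le> measure M {\<omega>\<in>space M. levy.window \<xi> 0 n \<omega> \<in> C}"
proof -
  interpret M: levy M \<xi> by unfold_locales fact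
  interpret N: levy N \<xi>' by unfold_locales (use dual in \<open>simp add: dual_levy_process_def\<close>)
  let ?L = "\<lambda>m \<omega>. (\<Sum>l<n * 2 ^ m. exp (\<xi>' (real l / 2 ^ m) \<omega>)) / 2 ^ m"
  let ?R = "\<lambda>m \<omega>. right_sum (\<lambda>s. exp (\<xi>' s \<omega>)) n m"
  have meas_R: "?R m \<in> borel_measurable N" for m
    unfolding right_sum_def by measurable
  have meas_clock: "exp_clock \<xi>' (real n) \<in> borel_measurable N"
    by (rule borel_measurable_LIMSEQ_real[OF N.right_sum_tendsto_exp_clock meas_R])
  show ?thesis
  proof (rule prob_limit_le_of_same_law[OF M.prob_space_axioms N.prob_space_axioms])
    show "distr M borel (\<lambda>\<omega>. right_sum (\<lambda>s. exp (\<xi> s \<omega>)) n m * exp (- \<xi> n \<omega>)) = distr N borel (?L m)"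
      for m
      using xi dual by (rule same_law_right_sums)
    show "(\<lambda>\<omega>. right_sum (\<lambda>s. exp (\<xi> s \<omega>)) n m * exp (- \<xi> n \<omega>)) \<in> borel_measurable M" for m
      unfolding right_sum_def by measurable
    show "?L m \<in> borel_measurable N" for m
      by measurable
    show "AE \<omega> in M. (\<lambda>m. right_sum (\<lambda>s. exp (\<xi> s \<omega>)) n m * exp (- \<xi> n \<omega>)) \<longlonglongrightarrow> M.window 0 n \<omega>"
    proof (rule AE_I2)
      fix \<omega> assume "\<omega> \<in> space M"
      then show "(\<lambda>m. right_sum (\<lambda>s. exp (\<xi> s \<omega>)) n m * exp (- \<xi> n \<omega>)) \<longlonglongrightarrow> M.window 0 n \<omega>"
        unfolding M.window_def using M.exp_clock_0
        by (auto intro!: tendsto_intros M.right_sum_tendsto_exp_clock)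
    qed
    show "AE \<omega> in N. (\<lambda>m. ?L m \<omega>) \<longlonglongrightarrow> exp_clock \<xi>' (real n) \<omega>"
    proof (rule AE_I2)
      fix \<omega> assume \<omega>: "\<omega> \<in> space N"
      let ?e = "\<lambda>s. exp (\<xi>' s \<omega>)"
      have "?L m \<omega> = ?R m \<omega> + (?e 0 - ?e n) * (1 / 2 ^ m)" for m
      proof -
        have "(\<Sum>l<n * 2 ^ m. ?e (real l / 2 ^ m)) - (\<Sum>l<n * 2 ^ m. ?e (real (Suc l) / 2 ^ m))
            = ?e 0 - ?e (real (n * 2 ^ m) / 2 ^ m)"
          using sum_lessThan_telescope'[of "\<lambda>l. ?e (real l / 2 ^ m)" "n * 2 ^ m"]
          by (simp add: sum_subtractf)
        then have "(\<Sum>l<n * 2 ^ m. ?e (real l / 2 ^ m))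
            = (\<Sum>l<n * 2 ^ m. ?e (real (Suc l) / 2 ^ m)) + (?e 0 - ?e n)"
          by simp
        then show ?thesis
          unfolding right_sum_def by (simp add: add_divide_distrib)
      qed
      moreover have "(\<lambda>m. 1 / 2 ^ m :: real) \<longlonglongrightarrow> 0"
        by (rule LIMSEQ_divide_realpow_zero) auto
      from tendsto_add[OF N.right_sum_tendsto_exp_clock[OF \<omega>, of n]
          tendsto_mult[OF tendsto_const[of "?e 0 - ?e n"] this]]
      have "(\<lambda>m. ?R m \<omega> + (?e 0 - ?e n) * (1 / 2 ^ m)) \<longlonglongrightarrow> exp_clock \<xi>' (real n) \<omega>"
        by simp
      ultimately show "(\<lambda>m. ?L m \<omega>) \<longlonglongrightarrow> exp_clock \<xi>' (real n) \<omega>"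
        by simp
    qed
  qed (use meas_clock U C UC in auto)
qed

section \<open>From the limit points to the process\<close>

lemma (in levy) measurable_exp_functional: "exp_functional \<xi> \<in> borel_measurable M"
proof -
  have "(\<lambda>(\<omega>, s). indicator {0..} s * exp (\<xi> s \<omega>)) \<in> borel_measurable (M \<Otimes>\<^sub>M lborel)"
    by (rule borel_measurable_cadlag_pair[OF _ cadlag_exp_path]) measurable
  then have "(\<lambda>\<omega>. LINT s|lborel. indicator {0..} s * exp (\<xi> s \<omega>)) \<in> borel_measurable M"
    by (intro lborel.borel_measurable_lebesgue_integral) (simp add: case_prod_beta)
  then show ?thesis
    by (simp add: exp_functional_def[abs_def] set_lebesgue_integral_def)
qed

text \<open>A divergent Bochner integral has the value 0, so a nonzero value certifies integrability.\<close>

lemma exp_clock_tendsto_exp_functional: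
  assumes "exp_functional \<xi> \<omega> \<noteq> 0"
  shows "(\<lambda>n. exp_clock \<xi> (real n) \<omega>) \<longlonglongrightarrow> exp_functional \<xi> \<omega>"
proof -
  have "set_integrable lborel {0..} (\<lambda>s. exp (\<xi> s \<omega>))"
    using assms not_integrable_integral_eq
    unfolding exp_functional_def set_lebesgue_integral_def set_integrable_def by blast
  then have "((\<lambda>b. exp_clock \<xi> b \<omega>) \<longlongrightarrow> exp_functional \<xi> \<omega>) at_top"
    unfolding exp_clock_def exp_functional_def by (intro tendsto_set_lebesgue_integral_at_top) auto
  then show ?thesis
    using filterlim_real_sequentially by (rule filterlim_compose)
qed

lemma strict_mono_on_exp_clock:
  assumes cadlag: "cadlag (\<lambda>t. \<xi> t \<omega>)"
  shows "strict_mono_on {0..} (\<lambda>s. exp_clock \<xi> s \<omega>)"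
proof (rule strict_mono_onI)
  fix s t :: real assume st: "s \<in> {0..}" "t \<in> {0..}" "s < t"
  obtain C where C: "\<And>r. 0 \<le> r \<Longrightarrow> r \<le> t \<Longrightarrow> \<bar>\<xi> r \<omega>\<bar> \<le> C"
    using cadlag_bounded[OF cadlag] by metis
  have "cadlag (\<lambda>t. exp (\<xi> t \<omega>))"
    using cadlag by (rule cadlag_exp)
  then have int: "set_integrable lborel {0..t} (\<lambda>s. exp (\<xi> s \<omega>))"
    by (rule cadlag_set_integrable)
  have int': "set_integrable lborel {0..s} (\<lambda>s. exp (\<xi> s \<omega>))"
       "set_integrable lborel {s<..t} (\<lambda>s. exp (\<xi> s \<omega>))"
    using st by (auto intro: set_integrable_subset[OF int])
  have "exp_clock \<xi> t \<omega> = exp_clock \<xi> s \<omega> + (LINT r:{s<..t}|lborel. exp (\<xi> r \<omega>))"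
  proof -
    have "{0..t} = {0..s} \<union> {s<..t}"
      using st by auto
    then show ?thesis
      unfolding exp_clock_def using int' by (simp only:) (intro set_integral_Un, auto)
  qed
  moreover have "(LINT r:{s<..t}|lborel. exp (- C)) \<le> (LINT r:{s<..t}|lborel. exp (\<xi> r \<omega>))"
  proof (rule set_integral_mono)
    show "exp (- C) \<le> exp (\<xi> r \<omega>)" if "r \<in> {s<..t}" for r
      using C[of r] st that by auto
    show "set_integrable lborel {s<..t} (\<lambda>_. exp (- C))"
      unfolding set_integrable_def real_scaleR_def
      by (rule integrable_mult_left) (use st in simp)
  qed (fact int')
  moreover have "(LINT r:{s<..t}|lborel. exp (- C)) = (t - s) * exp (- C)"
    using st by (simp add: set_lebesgue_integral_def)
  moreover have "0 < (t - s) * exp (- C)"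
    using st by simp
  ultimately show "exp_clock \<xi> s \<omega> < exp_clock \<xi> t \<omega>"
    by linarith
qed

text \<open>The clock is injective, hence its inverse takes the value \<open>s\<close> at \<open>exp_clock \<xi> s \<omega>\<close>; the time
  \<open>t = ln (1 + u I(s))\<close> of \<open>U\<close> is the one whose clock reading \<open>(exp t - 1) / u\<close> is \<open>I(s)\<close>.\<close>

lemma (in levy) OU_process_inverse:
  assumes \<omega>: "\<omega> \<in> space M" and "u > 0" "s \<ge> 0"
  obtains t where "t \<ge> 0" "OU_process \<xi> u t \<omega> = 1 / ((1 / u + exp_clock \<xi> s \<omega>) * exp (- \<xi> s \<omega>))"
proof
  let ?I = "\<lambda>s. exp_clock \<xi> s \<omega>"
  define t where "t = ln (1 + u * ?I s)"
  have mono: "strict_mono_on {0..} ?I"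
    using cadlag_path[OF \<omega>] by (rule strict_mono_on_exp_clock)
  have "0 \<le> ?I s"
    using strict_mono_on_leD[OF mono, of 0 s] exp_clock_0[OF \<omega>] \<open>s \<ge> 0\<close> by simp
  then have pos: "0 < 1 + u * ?I s" "0 \<le> u * ?I s"
    using \<open>u > 0\<close> by (auto intro: add_pos_nonneg)
  then show "t \<ge> 0"
    by (simp add: t_def)
  have exp_t: "exp t = 1 + u * ?I s"
    using pos by (simp add: t_def)
  have "time_change \<xi> (?I s) \<omega> = s"
    unfolding time_change_def
    using strict_mono_on_imp_inj_on[OF mono] \<open>s \<ge> 0\<close> by (intro the_inv_into_f_f) auto
  moreover have "(exp t - 1) / u = ?I s"
    using \<open>u > 0\<close> by (simp add: exp_t)
  ultimately have "OU_process \<xi> u t \<omega> = u * exp (\<xi> s \<omega>) / (1 + u * ?I s)"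
    unfolding OU_process_def pssmp_def pssmp_one_def by (simp add: exp_minus exp_t field_simps)
  also have "\<dots> = 1 / ((1 / u + ?I s) * exp (- \<xi> s \<omega>))"
    using \<open>u > 0\<close> pos by (simp add: exp_minus field_simps)
  finally show "OU_process \<xi> u t \<omega> = 1 / ((1 / u + ?I s) * exp (- \<xi> s \<omega>))" .
qed

theorem corollary3p1:
  fixes M :: "'a measure" and \<xi> :: "real \<Rightarrow> 'a \<Rightarrow> real"
    and N :: "'b measure" and \<xi>' :: "real \<Rightarrow> 'b \<Rightarrow> real"
    and \<mu> :: "real measure" and \<I> :: "real set"
  assumes "levy_process M \<xi>"
    and "drifts_to_infinity M \<xi>"
    and "\<not> pure_drift M \<xi>"
    and "dual_levy_process M \<xi> N \<xi>'"
    and "\<mu> = distr N borel (exp_functional \<xi>')"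
    and "\<I> = measure_support \<mu>"
  shows "\<forall>x u. x > 0 \<longrightarrow> 1 / x \<in> interior \<I> \<longrightarrow> u > 0 \<longrightarrow>
           (AE \<omega> in M. \<forall>V. x \<in> interior V \<longrightarrow> (\<exists>t\<ge>0. OU_process \<xi> u t \<omega> \<in> V))"
proof (intro allI impI)
  fix x u :: real
  assume x: "x > 0" and x_supp: "1 / x \<in> interior \<I>" and u: "u > 0"
  interpret M: levy M \<xi> by unfold_locales fact
  interpret N: levy N \<xi>'
    by unfold_locales (use assms in \<open>simp add: dual_levy_process_def\<close>)
  \<comment> \<open>For \<open>c < 1 / x\<close> the ball around \<open>1 / x\<close> avoids 0, the default value of a divergent functional.\<close>
  have near: "AE \<omega> in M. recurs_near (1 / x) c (\<lambda>n. M.window 0 n \<omega>)" if c: "0 < c" "c < 1 / x" for c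
  proof -
    let ?U = "ball (1 / x) c" and ?C = "cball (1 / x) c"
    note [measurable] = N.measurable_exp_functional
    define p where "p = measure N {\<omega>\<in>space N. exp_functional \<xi>' \<omega> \<in> ?U}"
    have "emeasure \<mu> ?U > 0"
      using x_supp interior_subset[of \<I>] c unfolding assms(6) measure_support_def by auto
    moreover have "emeasure \<mu> ?U = p"
      unfolding assms(5) p_def
      by (subst emeasure_distr) (auto simp: N.emeasure_eq_measure vimage_def Int_def conj_commute)
    ultimately have "p > 0"
      by simp
    have meas_clock: "exp_clock \<xi>' (real n) \<in> borel_measurable N" for n
      by (rule borel_measurable_LIMSEQ_real[OF N.right_sum_tendsto_exp_clock])
         (auto simp: right_sum_def)
    have "\<forall>\<^sub>F n in sequentially. p / 2 < measure N {\<omega>\<in>space N. exp_clock \<xi>' (real n) \<omega> \<in> ?U}"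
    proof (rule N.eventually_prob_gt[where A = "{\<omega>\<in>space N. exp_functional \<xi>' \<omega> \<in> ?U}"])
      show "AE \<omega> in N. \<omega> \<in> {\<omega>\<in>space N. exp_functional \<xi>' \<omega> \<in> ?U} \<longrightarrow>
          (\<forall>\<^sub>F n in sequentially. \<omega> \<in> {\<omega>\<in>space N. exp_clock \<xi>' (real n) \<omega> \<in> ?U})"
      proof (intro AE_I2 impI)
        fix \<omega> assume "\<omega> \<in> {\<omega>\<in>space N. exp_functional \<xi>' \<omega> \<in> ?U}"
        then have \<omega>: "\<omega> \<in> space N" "exp_functional \<xi>' \<omega> \<in> ?U"
          by auto
        then have "exp_functional \<xi>' \<omega> \<noteq> 0"
          using c by (auto simp: dist_real_def)
        from topological_tendstoD[OF exp_clock_tendsto_exp_functional[OF this] open_ball \<omega>(2)]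
        show "\<forall>\<^sub>F n in sequentially. \<omega> \<in> {\<omega>\<in>space N. exp_clock \<xi>' (real n) \<omega> \<in> ?U}"
          using \<omega>(1) by simp
      qed
      show "p / 2 < measure N {\<omega>\<in>space N. exp_functional \<xi>' \<omega> \<in> ?U}"
        using \<open>p > 0\<close> unfolding p_def[symmetric] by simp
    qed (use meas_clock in auto)
    then have "\<forall>\<^sub>F n in sequentially. p / 2 \<le> measure M {\<omega>\<in>space M. M.window 0 n \<omega> \<in> ?C}"
      by (rule eventually_mono)
         (rule order.trans[OF less_imp_le
            prob_exp_clock_le_window[OF assms(1,4) open_ball closed_cball ball_subset_cball]])
    then have "\<exists>\<^sub>F n in sequentially. p / 2 \<le> measure M {\<omega>\<in>space M. \<bar>M.window 0 n \<omega> - 1 / x\<bar> \<le> c}"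
      by (intro eventually_frequently) (auto simp: dist_real_def abs_minus_commute)
    then show ?thesis
      using \<open>p > 0\<close> by (intro M.AE_recurs_near_window[OF assms(2), of "p / 2"]) auto
  qed
  \<comment> \<open>These radii lie in \<open>(0, 1 / x)\<close> and tend to 0.\<close>
  have "AE \<omega> in M. recurs_near (1 / x) (1 / x / real (j + 2)) (\<lambda>n. M.window 0 n \<omega>)" for j
  proof (rule near)
    show "0 < 1 / x / real (j + 2)"
      using x by simp
    show "1 / x / real (j + 2) < 1 / x"
      using divide_strict_left_mono[of 1 "real (j + 2)" "1 / x"] x by simp
  qed
  then have "AE \<omega> in M. \<forall>j. recurs_near (1 / x) (1 / x / real (j + 2)) (\<lambda>n. M.window 0 n \<omega>)"
    by (simp add: AE_all_countable)
  then show "AE \<omega> in M. \<forall>V. x \<in> interior V \<longrightarrow> (\<exists>t\<ge>0. OU_process \<xi> u t \<omega> \<in> V)"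
    using assms(2)[unfolded drifts_to_infinity_def] AE_space
  proof eventually_elim
    case (elim \<omega>)
    define Z where "Z n = (1 / u + exp_clock \<xi> (real n) \<omega>) * exp (- \<xi> (real n) \<omega>)" for n
    have "filterlim (\<lambda>n. \<xi> (real n) \<omega>) at_top sequentially"
      using elim(2) filterlim_real_sequentially by (rule filterlim_compose)
    then have "filterlim (\<lambda>n. - \<xi> (real n) \<omega>) at_bot sequentially"
      by (simp add: filterlim_uminus_at_bot)
    then have "(\<lambda>n. exp (- \<xi> (real n) \<omega>)) \<longlonglongrightarrow> 0"
      by (rule filterlim_compose[OF exp_at_bot])
    from tendsto_mult_right_zero[OF this, of "- 1 / u"]
    have diff: "(\<lambda>n. M.window 0 n \<omega> - Z n) \<longlonglongrightarrow> 0"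
      using M.exp_clock_0[OF elim(3)] by (simp add: M.window_def Z_def algebra_simps)
    show ?case
    proof (intro allI impI)
      fix V assume "x \<in> interior V"
      moreover have "((\<lambda>z. 1 / z) \<longlongrightarrow> 1 / (1 / x)) (nhds (1 / x))"
        using x by (intro tendsto_intros) (auto simp: filterlim_ident)
      ultimately have "\<forall>\<^sub>F z in nhds (1 / x). 1 / z \<in> interior V"
        by (intro topological_tendstoD) auto
      then obtain e where e: "e > 0" "\<And>z. \<bar>z - 1 / x\<bar> < e \<Longrightarrow> 1 / z \<in> interior V"
        by (auto simp: eventually_nhds_metric dist_real_def)
      have "(\<lambda>j. 1 / x / real (j + 2)) \<longlonglongrightarrow> 0"
        by real_asymp
      then have "\<forall>\<^sub>F j in sequentially. 1 / x / real (j + 2) < e / 2"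
        using e by (intro order_tendstoD) auto
      moreover have "(\<lambda>j. 1 / real (Suc j)) \<longlonglongrightarrow> 0"
        by real_asymp
      then have "\<forall>\<^sub>F j in sequentially. 1 / real (Suc j) < e / 2"
        using e by (intro order_tendstoD) auto
      ultimately obtain j where j: "1 / x / real (j + 2) < e / 2" "1 / real (Suc j) < e / 2"
        using eventually_happens'[OF sequentially_bot eventually_conj] by blast
      have "recurs_near (1 / x) (1 / x / real (j + 2)) Z"
        using recurs_near_perturb[OF _ diff] elim(1) by blast
      then have "\<exists>\<^sub>F n in sequentially. \<bar>Z n - 1 / x\<bar> < 1 / x / real (j + 2) + 1 / real (Suc j)"
        unfolding recurs_near_def by blast
      then obtain n where "\<bar>Z n - 1 / x\<bar> < 1 / x / real (j + 2) + 1 / real (Suc j)"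
        by (auto dest: frequently_ex)
      then have "1 / Z n \<in> interior V"
        using j by (intro e) linarith
      moreover obtain t where "t \<ge> 0" "OU_process \<xi> u t \<omega> = 1 / Z n"
        using M.OU_process_inverse[OF elim(3) u, of "real n"] unfolding Z_def by auto
      ultimately show "\<exists>t\<ge>0. OU_process \<xi> u t \<omega> \<in> V"
        using interior_subset[of V] by (intro exI[of _ t]) auto
    qed
  qed
qed

end
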